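(* Let $r\in\mathbb{N}$. For any $m_1,\ldots,m_r\in \mathbb{N}$, with $m=\operatorname{lcm}[m_1,\ldots,m_r]$, $$E(m_1,\ldots,m_r)= \frac1{m}\sum_{d\mid m} c_{m_1}(d)\cdots c_{m_r}(d)\,\phi(m/d).$$
   Context: $\mathbb{N}=\{1,2,\ldots\}$. $\phi$ is Euler's totient function. For $n,k\in\mathbb{N}$ the Ramanujan sum is $c_n(k)=\sum_{1\le j\le n,\ \gcd(j,n)=1}\exp(2\pi i jk/n)$. For $m_1,\ldots,m_r\in\mathbb{N}$ with $m=\operatorname{lcm}[m_1,\ldots,m_r]$, the function $E$ is defined by $E(m_1,\ldots,m_r)=\frac1{M}\sum_{k=1}^M c_{m_1}(k)\cdots c_{m_r}(k)$, where $M$ is any positive integer with $m\mid M$ (the value does not depend on the choice of $M$, so one may take $M=m$). The sum in the claim is over positive divisors $d$ of $m$. *)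

theory Defs
  imports Complex_Main "HOL-Number_Theory.Totient"
begin

definition ramanujan_sum :: "nat \<Rightarrow> nat \<Rightarrow> complex" where
  "ramanujan_sum n k =
     (\<Sum>j | 1 \<le> j \<and> j \<le> n \<and> gcd j n = 1.
        exp (2 * complex_of_real pi * \<i> * of_nat j * of_nat k / of_nat n))"

text \<open>
  The tuple of moduli is a function \<open>ms\<close> of which only the values at \<open>1, \<dots>, r\<close> matter.
  The mean is taken over \<open>{1..M}\<close> with \<open>M\<close> the least common multiple of the moduli;
  lemma \<open>E_eq_mean\<close> shows that any positive multiple may be used instead.
\<close>

definition E :: "nat \<Rightarrow> (nat \<Rightarrow> nat) \<Rightarrow> complex" where
  "E r ms =
     (let M = Lcm (ms ` {1..r})
      in 1 / of_nat M * (\<Sum>k=1..M. \<Prod>i=1..r. ramanujan_sum (ms i) k))"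

lemma ramanujan_sum_periodic:
  assumes "n dvd m"
  shows "ramanujan_sum n (k + m) = ramanujan_sum n k"
proof (cases "n = 0")
  case True
  then show ?thesis by (simp add: ramanujan_sum_def)
next
  case False
  obtain q where q: "m = n * q" using assms by blast
  have "exp (2 * complex_of_real pi * \<i> * of_nat j * of_nat (k + m) / of_nat n)
      = exp (2 * complex_of_real pi * \<i> * of_nat j * of_nat k / of_nat n)" for j :: nat
  proof -
    have "2 * complex_of_real pi * \<i> * of_nat j * of_nat (k + m) / of_nat n
        = 2 * complex_of_real pi * \<i> * of_nat j * of_nat k / of_nat n
          + 2 * of_nat (j * q) * complex_of_real pi * \<i>"
      using False by (simp add: q field_simps)
    moreover have "exp (2 * of_nat (j * q) * complex_of_real pi * \<i>) = 1"
    proof -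
      have "exp (2 * of_nat (j * q) * complex_of_real pi * \<i>)
          = exp (of_nat (j * q) * (2 * complex_of_real pi * \<i>))"
        by (simp add: ac_simps)
      also have "\<dots> = exp (2 * complex_of_real pi * \<i>) ^ (j * q)"
        by (rule exp_of_nat_mult)
      also have "\<dots> = 1" by simp
      finally show ?thesis .
    qed
    ultimately show ?thesis by (simp only: exp_add mult_1_right)
  qed
  then show ?thesis by (simp add: ramanujan_sum_def)
qed

lemma sum_periodic:
  fixes f :: "nat \<Rightarrow> complex"
  assumes "\<And>k. f (k + m) = f k"
  shows "(\<Sum>k=1..m * q. f k) = of_nat q * (\<Sum>k=1..m. f k)"
proof (induction q)
  case 0
  show ?case by simp
next
  case (Suc q)
  have per: "f (k + m * q) = f k" for k
  proof (induction q)
    case 0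
    show ?case by simp
  next
    case (Suc q)
    then show ?case using assms[of "k + m * q"] by (simp add: ac_simps)
  qed
  have "(\<Sum>k=1..m * Suc q. f k) = (\<Sum>k=1..m * q. f k) + (\<Sum>k=m * q + 1..m * q + m. f k)"
    using sum.ub_add_nat[of 1 "m * q" f m] by (simp add: add.commute[of m])
  also have "(\<Sum>k=m * q + 1..m * q + m. f k) = (\<Sum>k=1..m. f (k + m * q))"
    using sum.shift_bounds_cl_nat_ivl[of f 1 "m * q" m] by (simp add: ac_simps)
  also have "\<dots> = (\<Sum>k=1..m. f k)" by (simp only: per)
  finally show ?case unfolding Suc.IH by (simp add: algebra_simps)
qed

lemma E_eq_mean:
  assumes "M > 0" and "Lcm (ms ` {1..r}) dvd M"
  shows "E r ms = 1 / of_nat M * (\<Sum>k=1..M. \<Prod>i=1..r. ramanujan_sum (ms i) k)"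
proof -
  define m where "m = Lcm (ms ` {1..r})"
  obtain q where q: "M = m * q" using assms(2) by (auto simp: m_def)
  have "m > 0" "q > 0" using assms(1) q by auto
  have "(\<Prod>i=1..r. ramanujan_sum (ms i) (k + m)) = (\<Prod>i=1..r. ramanujan_sum (ms i) k)" for k
    by (intro prod.cong refl ramanujan_sum_periodic) (auto simp: m_def intro!: dvd_Lcm)
  from sum_periodic[where f = "\<lambda>k. \<Prod>i=1..r. ramanujan_sum (ms i) k", OF this, of q]
  show ?thesis using \<open>m > 0\<close> \<open>q > 0\<close>
    unfolding E_def Let_def m_def[symmetric] by (simp add: q)
qed

end

theory Submission
  imports Defs
begin

text \<open>
  The divisor sum $\sum_{d \mid n} c_d(k)$ equals the sum of the $k$-th powers of all $n$-th roots
  of unity, which is $n$ if $n \mid k$ and $0$ otherwise. By strong induction on $n$ (in place of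
  Moebius inversion), $c_n(k)$ depends only on $\gcd(k, n)$; so for $n \mid m$ one has
  $c_n(k) = c_n(\gcd(k, m))$. Grouping the mean by $d = \gcd(k, m)$, a value taken
  by $\phi(m/d)$ of the $k \le m$, gives the formula.
\<close>

lemma ramanujan_sum_eq_sum_cis_power:
  "ramanujan_sum n k = (\<Sum>j\<in>totatives n. cis (2 * pi * real k / real n) ^ j)"
proof -
  have "{j. 1 \<le> j \<and> j \<le> n \<and> gcd j n = 1} = totatives n"
    by (auto simp: in_totatives_iff coprime_iff_gcd_eq_1)
  moreover have "exp (2 * complex_of_real pi * \<i> * of_nat j * of_nat k / of_nat n) =
      cis (2 * pi * real k / real n) ^ j" for j :: nat
    unfolding DeMoivre by (simp add: cis_conv_exp ac_simps)
  ultimately show ?thesis by (simp add: ramanujan_sum_def)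
qed

lemma sum_group_by_gcd:
  fixes g :: "nat \<Rightarrow> 'a :: comm_monoid_add"
  assumes "n > 0"
  shows "(\<Sum>j=1..n. g j) = (\<Sum>d | d dvd n. \<Sum>j | j \<in> {0<..n} \<and> gcd j n = d. g j)"
proof -
  have "{0<..n} = {1..n}" by auto
  with sum.group[of "{0<..n}" "{d. d dvd n}" "\<lambda>j. gcd j n" g] assms show ?thesis
    by (simp add: image_subset_iff)
qed

lemma cis_2pi_frac_eq_1_iff:
  assumes "n > 0"
  shows "cis (2 * pi * real k / real n) = 1 \<longleftrightarrow> n dvd k"
proof
  assume "cis (2 * pi * real k / real n) = 1"
  then have "cos (2 * pi * real k / real n) = 1" by (simp add: complex_eq_iff)
  then obtain x :: int where "2 * pi * real k / real n = of_int x * 2 * pi"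
    unfolding cos_one_2pi_int by blast
  then have "real k = of_int x * real n" using assms by (simp add: field_simps)
  then have "int k = x * int n" by (metis of_int_eq_iff of_int_mult of_int_of_nat_eq)
  then show "n dvd k" by (metis dvd_triv_right int_dvd_int_iff)
next
  assume "n dvd k"
  then obtain q where "k = n * q" by blast
  then show "cis (2 * pi * real k / real n) = 1"
    using assms cis_multiple_2pi[of "real q"] by (simp add: mult.assoc)
qed

lemma sum_ramanujan_sum_divisors:
  assumes "n > 0"
  shows "(\<Sum>d | d dvd n. ramanujan_sum d k) = (if n dvd k then of_nat n else 0)"
proof -
  define w where "w = cis (2 * pi * real k / real n)"
  have "(\<Sum>d | d dvd n. ramanujan_sum d k) = (\<Sum>d | d dvd n. ramanujan_sum (n div d) k)"
    using assms by (intro sum.reindex_bij_witness[of _ "(div) n" "(div) n"]) (auto elim: dvdE)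
  also have "\<dots> = (\<Sum>d | d dvd n. \<Sum>j | j \<in> {0<..n} \<and> gcd j n = d. w ^ j)"
  proof (intro sum.cong refl)
    fix d assume "d \<in> {d. d dvd n}"
    then have "d dvd n" by simp
    then have "cis (2 * pi * real k / real (n div d)) = w ^ d"
      using assms by (auto simp: w_def DeMoivre real_of_nat_div field_simps)
    then have "ramanujan_sum (n div d) k = (\<Sum>l\<in>totatives (n div d). w ^ (l * d))"
      by (simp add: ramanujan_sum_eq_sum_cis_power mult.commute[of _ d] power_mult)
    then show "ramanujan_sum (n div d) k = (\<Sum>j | j \<in> {0<..n} \<and> gcd j n = d. w ^ j)"
      using sum.reindex_bij_betw[OF bij_betw_totatives_gcd_eq[OF \<open>d dvd n\<close> assms],
          of "\<lambda>j. w ^ j"] by simp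
  qed
  also have "\<dots> = (\<Sum>j=1..n. w ^ j)"
    by (rule sum_group_by_gcd[OF assms, symmetric])
  also have "\<dots> = w * (\<Sum>j<n. w ^ j)"
    by (simp add: sum_distrib_left sum.atLeast1_atMost_eq)
  also have "\<dots> = (if n dvd k then of_nat n else 0)"
  proof (cases "n dvd k")
    case True
    then have "w = 1" using assms by (simp add: w_def cis_2pi_frac_eq_1_iff)
    then show ?thesis using True by simp
  next
    case False
    then have "w \<noteq> 1" using assms by (simp add: w_def cis_2pi_frac_eq_1_iff)
    moreover have "w ^ n = 1"
      using assms cis_multiple_2pi[of "real k"] by (simp add: w_def DeMoivre)
    ultimately show ?thesis using False by (simp add: geometric_sum)
  qed
  finally show ?thesis .
qed

lemma ramanujan_sum_cong_gcd:
  assumes "n > 0" and "gcd k n = gcd l n"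
  shows "ramanujan_sum n k = ramanujan_sum n l"
  using assms
proof (induction n rule: less_induct)
  case (less n)
  have "ramanujan_sum d k = ramanujan_sum d l" if d: "d dvd n" "d \<noteq> n" for d
  proof (rule less.IH)
    show "d < n" "d > 0" using d less.prems(1) by (auto intro: Nat.gr0I dest: dvd_imp_le)
    show "gcd k d = gcd l d"
      using d(1) less.prems(2) by (metis gcd.assoc gcd_nat.absorb_iff2)
  qed
  then have "(\<Sum>d\<in>{d. d dvd n} - {n}. ramanujan_sum d k) =
      (\<Sum>d\<in>{d. d dvd n} - {n}. ramanujan_sum d l)"
    by (intro sum.cong) auto
  moreover have "n dvd k \<longleftrightarrow> n dvd l"
    using less.prems(2) by (metis gcd_nat.absorb_iff2)
  then have "(\<Sum>d | d dvd n. ramanujan_sum d k) = (\<Sum>d | d dvd n. ramanujan_sum d l)"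
    using less.prems(1) by (simp add: sum_ramanujan_sum_divisors)
  ultimately show ?case
    using less.prems(1) by (simp add: sum.remove[of _ n])
qed

theorem proposition9:
  fixes r m :: nat and ms :: "nat \<Rightarrow> nat"
  assumes "r \<ge> 1"
    and "\<And>i. i \<in> {1..r} \<Longrightarrow> ms i \<ge> 1"
    and "m = Lcm (ms ` {1..r})"
  shows "E r ms =
           1 / of_nat m *
             (\<Sum>d | d dvd m. (\<Prod>i=1..r. ramanujan_sum (ms i) d) * of_nat (totient (m div d)))"
proof -
  define f where "f k = (\<Prod>i=1..r. ramanujan_sum (ms i) k)" for k
  have "0 \<notin> ms ` {1..r}" using assms(2) by force
  then have "m > 0" unfolding assms(3) by (intro Nat.gr0I) (simp add: Lcm_0_iff)
  have f_gcd: "f k = f (gcd k m)" for k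
    unfolding f_def
  proof (intro prod.cong refl ramanujan_sum_cong_gcd)
    fix i assume i: "i \<in> {1..r}"
    show "ms i > 0" using assms(2)[OF i] by simp
    have "ms i dvd m" unfolding assms(3) using i by (intro dvd_Lcm) auto
    then show "gcd k (ms i) = gcd (gcd k m) (ms i)" by (metis gcd.assoc gcd_nat.absorb_iff2)
  qed
  have "(\<Sum>k=1..m. f k) = (\<Sum>d | d dvd m. \<Sum>k | k \<in> {0<..m} \<and> gcd k m = d. f k)"
    by (rule sum_group_by_gcd[OF \<open>m > 0\<close>])
  also have "\<dots> = (\<Sum>d | d dvd m. f d * of_nat (totient (m div d)))"
  proof (intro sum.cong refl)
    fix d assume "d \<in> {d. d dvd m}"
    then have card: "card {k \<in> {0<..m}. gcd k m = d} = totient (m div d)"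
      using card_gcd_eq_totient \<open>m > 0\<close> by simp
    have "(\<Sum>k | k \<in> {0<..m} \<and> gcd k m = d. f k) = (\<Sum>k | k \<in> {0<..m} \<and> gcd k m = d. f d)"
      by (intro sum.cong refl) (use f_gcd in auto)
    then show "(\<Sum>k | k \<in> {0<..m} \<and> gcd k m = d. f k) = f d * of_nat (totient (m div d))"
      by (simp only: sum_constant card mult.commute)
  qed
  finally show ?thesis
    by (simp add: E_def Let_def assms(3) f_def)
qed

end
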